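(* Let $0 < \beta < 1$ and $\alpha_1, \alpha_2 \ge 1$, let $S$ be a stream of items from a set $X$, and let $f: 2^X \to \mathbb{R}^+$ be a non-decreasing function. Suppose there exists an $(f, \alpha_1, \alpha_2, \beta)$-refined lookahead algorithm that uses space $s$. Then there exists a sliding window algorithm that maintains an $\alpha_2$-approximation of $f$ (i.e., after each item it reports a value $v$ with $v \le f(E) \le \alpha_2 v$, where $E$ is the set of the $L$ most recent items) using space $O\bigl(\frac{1}{\beta}\cdot s \log(\alpha_1 \sigma)\bigr)$, where $\sigma = \sigma_f(S)$.
   Context: A stream is a sequence of items of a ground set $X$; for streams $A, B, C$, $AB$ and $ABC$ denote concatenations, and $f$ applied to a stream means $f$ applied to its set of items. In the sliding window model with window length $L$, the current window is the set of the $L$ most recently processed items. $\sigma_f(S) = f(S)/f_{\min}$, where $f_{\min} = \min\{ f(\{e\}) : e \in S\}$. Definition: Let $\beta \in (0,1)$, $\alpha_1, \alpha_2 \ge 1$, and $f: 2^X \to \mathbb{R}^+$ non-decreasing. A streaming algorithm $\mathcal{ALG}$ with two outputs $\mathcal{ALG}_1, \mathcal{ALG}_2$ is an $(f, \alpha_1, \alpha_2, \beta)$-refined lookahead algorithm if for every stream $S$ of items of $X$: (1) $\mathcal{ALG}_1(S) \le f(S) \le \alpha_1 \cdot \mathcal{ALG}_1(S)$; and (2) for any partition of $S$ into three consecutive disjoint substreams $S = ABC$ with $\mathcal{ALG}_1(B) \ge (1-\beta)\cdot \mathcal{ALG}_1(AB)$, we have $\mathcal{ALG}_2(BC) \le f(ABC)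 \le \alpha_2 \cdot \mathcal{ALG}_2(BC)$.
   Formalization: The space bound is proved with 1 + ln(α₁σ) in place of log(α₁σ), since the literal bound is zero when α₁σ = 1 and then fails; space is counted in words, a timestamp up to L being one word, and σ requires S nonempty with f_min > 0. *)

theory Defs
  imports Complex_Main "HOL-Library.FuncSet" "HOL-Library.Sublist"
begin

text \<open>
  The memory of a streaming algorithm is a list of words, and space is counted in words.
  There is no restriction on how the update and the outputs are computed from the memory;
  an algorithm is limited only by what it can remember between two items.
\<close>

record ('a, 'w) streaming =
  init :: "'w list"
  update :: "'w list \<Rightarrow> 'a \<Rightarrow> 'w list"

record ('a, 'w) two_output_alg = "('a, 'w) streaming" +
  out1 :: "'w list \<Rightarrow> real"
  out2 :: "'w list \<Rightarrow> real"

record ('a, 'w) sliding_alg = "('a, 'w) streaming" +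
  out :: "'w list \<Rightarrow> real"

definition memory :: "('a, 'w, 'z) streaming_scheme \<Rightarrow> 'a list \<Rightarrow> 'w list" where
  "memory A S = foldl (update A) (init A) S"

definition ALG1 :: "('a, 'w) two_output_alg \<Rightarrow> 'a list \<Rightarrow> real" where
  "ALG1 A S = out1 A (memory A S)"

definition ALG2 :: "('a, 'w) two_output_alg \<Rightarrow> 'a list \<Rightarrow> real" where
  "ALG2 A S = out2 A (memory A S)"

text \<open>
  The set \<open>W\<close> of admissible words is a parameter: without it a single word of an infinite
  type could encode the whole history, and counting words would be meaningless.
\<close>

definition uses_space ::
  "('a, 'w, 'z) streaming_scheme \<Rightarrow> 'w set \<Rightarrow> real \<Rightarrow> 'a list \<Rightarrow> bool" where
  "uses_space A W b S \<longleftrightarrow>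
     (\<forall>P. prefix P S \<longrightarrow> memory A P \<in> lists W \<and> real (length (memory A P)) \<le> b)"

definition refined_lookahead ::
  "'a set \<Rightarrow> ('a set \<Rightarrow> real) \<Rightarrow> real \<Rightarrow> real \<Rightarrow> real \<Rightarrow> ('a, 'w) two_output_alg \<Rightarrow> bool" where
  "refined_lookahead X f \<alpha>\<^sub>1 \<alpha>\<^sub>2 \<beta> Alg \<longleftrightarrow>
     (\<forall>S \<in> lists X.
        (ALG1 Alg S \<le> f (set S) \<and> f (set S) \<le> \<alpha>\<^sub>1 * ALG1 Alg S) \<and>
        (\<forall>A B C. S = A @ B @ C \<and> ALG1 Alg B \<ge> (1 - \<beta>) * ALG1 Alg (A @ B) \<longrightarrow>
           ALG2 Alg (B @ C) \<le> f (set (A @ B @ C)) \<and>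
           f (set (A @ B @ C)) \<le> \<alpha>\<^sub>2 * ALG2 Alg (B @ C)))"

text \<open>While fewer than \<open>L\<close> items have been processed, the window consists of all of them.\<close>

definition window :: "nat \<Rightarrow> 'a list \<Rightarrow> 'a set" where
  "window L P = set (drop (length P - L) P)"

definition maintains_approx ::
  "('a set \<Rightarrow> real) \<Rightarrow> real \<Rightarrow> nat \<Rightarrow> ('a, 'w) sliding_alg \<Rightarrow> 'a list \<Rightarrow> bool" where
  "maintains_approx f \<alpha> L B S \<longleftrightarrow>
     (\<forall>P. prefix P S \<and> P \<noteq> [] \<longrightarrow>
        out B (memory B P) \<le> f (window L P) \<and>
        f (window L P) \<le> \<alpha> * out B (memory B P))"

definition f_min :: "('a set \<Rightarrow> real) \<Rightarrow> 'a list \<Rightarrow> real" where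
  "f_min f S = Min ((\<lambda>e. f {e}) ` set S)"

definition sigma :: "('a set \<Rightarrow> real) \<Rightarrow> 'a list \<Rightarrow> real" where
  "sigma f S = f (set S) / f_min f S"

end

theory Submission
  imports Defs
begin

text \<open>
  Run one copy of the lookahead algorithm from each of a few starting points, together with its
  age, and drop every starting point strictly between \<open>p\<close> and \<open>q\<close> as soon as the first output
  from \<open>q\<close> is at least \<open>1 - \<beta>\<close> times the one from \<open>p\<close>.  A window starting at a dropped point
  between \<open>p\<close> and \<open>q\<close> is then approximated for ever by the second output of the copy started at
  \<open>q\<close>: writing \<open>A\<close>, \<open>B\<close>, \<open>C\<close> for the items between \<open>p\<close> and \<open>q\<close>, from \<open>q\<close> until the time of the
  deletion, and after it, any suffix \<open>D\<close> of \<open>A\<close> satisfies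
  \<open>ALG2 (BC) \<le> f (BC) \<le> f (DBC) \<le> f (ABC) \<le> \<alpha>\<^sub>2 ALG2 (BC)\<close>.
  Among the surviving points the first output drops by the factor \<open>1 - \<beta>\<close> over every two
  consecutive steps, while it stays between \<open>f_min / \<alpha>\<^sub>1\<close> and \<open>f (S)\<close>, so at most
  \<open>2 + 2 ln (\<alpha>\<^sub>1 \<sigma>) / \<beta>\<close> points survive.
\<close>

section \<open>Thinning a list\<close>

text \<open>Amounts to the suffix from the last entry satisfying \<open>Q\<close>, or to the whole
  list if there is none; so the witness of a deletion always survives.\<close>

fun cut :: "('b \<Rightarrow> bool) \<Rightarrow> 'b list \<Rightarrow> 'b list" where
  "cut Q [] = []"
| "cut Q (y # ys) = (if \<exists>z\<in>set ys. Q z then cut Q ys else y # ys)"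

text \<open>The tail is thinned first: suffixes of a sparse list are sparse, so a single pass from
  the right suffices.\<close>

fun prune :: "('b \<Rightarrow> 'b \<Rightarrow> bool) \<Rightarrow> 'b list \<Rightarrow> 'b list" where
  "prune Q [] = []"
| "prune Q (x # xs) = x # cut (Q x) (prune Q xs)"

text \<open>The immediate successor is exempt, because \<open>cut\<close> may leave the witness
  right behind \<open>x\<close>.\<close>

fun sparse :: "('b \<Rightarrow> 'b \<Rightarrow> bool) \<Rightarrow> 'b list \<Rightarrow> bool" where
  "sparse Q (x # y # zs) \<longleftrightarrow> (\<forall>z\<in>set zs. \<not> Q x z) \<and> sparse Q (y # zs)"
| "sparse Q _ \<longleftrightarrow> True"

lemma cut_suffix: "suffix (cut Q ys) ys"
  by (induction ys) (auto intro: suffix_ConsI)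

lemma cut_eq_Nil_iff [simp]: "cut Q ys = [] \<longleftrightarrow> ys = []"
  by (induction ys) auto

lemma last_cut: "ys \<noteq> [] \<Longrightarrow> last (cut Q ys) = last ys"
  by (induction ys) auto

lemma cut_map: "cut Q (map g ys) = map g (cut (\<lambda>y. Q (g y)) ys)"
  by (induction ys) auto

lemma cut_eqD: "cut Q ys = z # zs \<Longrightarrow> (\<forall>y\<in>set zs. \<not> Q y) \<and> (Q z \<or> ys = z # zs)"
proof (induction ys)
  case (Cons y ys)
  show ?case
  proof (cases "\<exists>u\<in>set ys. Q u")
    case True
    with Cons show ?thesis by auto
  next
    case False
    with Cons show ?thesis by auto
  qed
qed simp

lemma prune_subset: "set (prune Q xs) \<subseteq> set xs"
proof (induction xs)
  case (Cons x xs)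
  then show ?case using set_mono_suffix[OF cut_suffix[of "Q x" "prune Q xs"]] by auto
qed simp

lemma prune_eq_Nil_iff [simp]: "prune Q xs = [] \<longleftrightarrow> xs = []"
  by (cases xs) auto

lemma hd_prune: "hd (prune Q xs) = hd xs"
  by (cases xs) auto

lemma last_prune: "last (prune Q xs) = last xs"
  by (induction xs) (auto simp: last_cut)

lemma prune_map: "prune Q (map g xs) = map g (prune (\<lambda>x y. Q (g x) (g y)) xs)"
  by (induction xs) (auto simp: cut_map)

lemma sparse_map: "sparse Q (map g xs) = sparse (\<lambda>x y. Q (g x) (g y)) xs"
  by (induction "\<lambda>x y. Q (g x) (g y)" xs rule: sparse.induct) auto

lemma sparse_ConsD: "sparse Q (x # xs) \<Longrightarrow> sparse Q xs"
  by (cases xs) auto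

lemma sparse_suffix: "suffix ys xs \<Longrightarrow> sparse Q xs \<Longrightarrow> sparse Q ys"
proof (induction xs)
  case (Cons x xs)
  then show ?case by (metis sparse_ConsD suffix_Cons)
qed simp

lemma sparse_prune: "sparse Q (prune Q xs)"
proof (induction xs)
  case (Cons x xs)
  show ?case
  proof (cases "cut (Q x) (prune Q xs)")
    case (Cons z zs)
    then have "sparse Q (z # zs)"
      using sparse_suffix[OF cut_suffix Cons.IH] by metis
    then show ?thesis using Cons cut_eqD[OF Cons] by auto
  qed auto
qed simp

lemma successively_suffix: "suffix ys xs \<Longrightarrow> successively R xs \<Longrightarrow> successively R ys"
  by (auto simp: suffix_def successively_append_iff)

text \<open>A neighbour \<open>z\<close> of \<open>x\<close> created by a cut satisfies
  \<open>Q x z\<close>. If nothing was cut, \<open>z\<close> is the old neighbour, since pruning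
  keeps heads.\<close>

lemma successively_prune:
  assumes "successively R xs" and "sorted_wrt T xs"
    and "\<And>x y. x \<in> set xs \<Longrightarrow> y \<in> set xs \<Longrightarrow> T x y \<Longrightarrow> Q x y \<Longrightarrow> R x y"
  shows "successively R (prune Q xs)"
  using assms
proof (induction xs)
  case (Cons x xs)
  have IH: "successively R (prune Q xs)"
    using Cons by (auto simp: successively_Cons)
  show ?case
  proof (cases "cut (Q x) (prune Q xs)")
    case Nil
    then show ?thesis by simp
  next
    case (Cons z zs)
    have z: "z \<in> set xs"
      using set_mono_suffix[OF cut_suffix[of "Q x" "prune Q xs"]] prune_subset[of Q xs] Cons by auto
    have "successively R (z # zs)"
      using successively_suffix[OF cut_suffix IH] Cons by metis
    moreover have "R x z"
    proof (cases "Q x z")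
      case True
      then show ?thesis using Cons.prems z by auto
    next
      case False
      then have "prune Q xs = z # zs" using cut_eqD[OF Cons] by auto
      then have "hd xs = z" "xs \<noteq> []" using hd_prune[of Q xs] by auto
      then show ?thesis using Cons.prems by (auto simp: successively_Cons)
    qed
    ultimately show ?thesis using Cons by simp
  qed
qed simp

text \<open>The third entry has a value below \<open>q\<close> times that of the first, so the
  induction removes two entries for each factor \<open>q\<close>.\<close>

lemma sparse_geometric_decay:
  fixes v :: "'b \<Rightarrow> real"
  assumes "sparse (\<lambda>x y. q * v x \<le> v y) xs" and "xs \<noteq> []" and "0 \<le> q"
    and "\<And>x. x \<in> set xs \<Longrightarrow> l \<le> v x"
  shows "l \<le> v (hd xs) * q ^ ((length xs - 1) div 2)"
  using assms
proof (induction xs rule: length_induct)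
  case (1 xs)
  show ?case
  proof (cases "\<exists>x y z zs. xs = x # y # z # zs")
    case True
    then obtain x y z zs where xs: "xs = x # y # z # zs" by blast
    have "l \<le> v (hd (z # zs)) * q ^ ((length (z # zs) - 1) div 2)"
      using 1 xs by (intro "1.IH"[rule_format]) (auto dest: sparse_ConsD)
    also have "\<dots> \<le> (q * v x) * q ^ ((length (z # zs) - 1) div 2)"
      using 1 xs by (intro mult_right_mono) auto
    also have "\<dots> = v (hd xs) * q ^ ((length xs - 1) div 2)"
      by (simp add: xs)
    finally show ?thesis .
  next
    case False
    then have "(length xs - 1) div 2 = 0"
      using "1.prems"(2) by (cases xs; cases "tl xs"; cases "tl (tl xs)") auto
    then show ?thesis using "1.prems" by simp
  qed
qed

lemma sparse_length_bound:
  fixes v :: "'b \<Rightarrow> real"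
  assumes sp: "sparse (\<lambda>x y. (1 - \<beta>) * v x \<le> v y) xs" and \<beta>: "0 < \<beta>" "\<beta> < 1"
    and l: "0 < l" "l \<le> U" and v: "\<And>x. x \<in> set xs \<Longrightarrow> l \<le> v x \<and> v x \<le> U"
  shows "real (length xs) \<le> 2 / \<beta> * (1 + ln (U / l))"
proof (cases "xs = []")
  case True
  have "0 \<le> ln (U / l)" using l by simp
  then show ?thesis using True \<beta> by simp
next
  case False
  define k where "k = (length xs - 1) div 2"
  have "l \<le> v (hd xs) * (1 - \<beta>) ^ k"
    unfolding k_def by (rule sparse_geometric_decay[OF sp False]) (use \<beta> v in auto)
  also have "\<dots> \<le> U * (1 - \<beta>) ^ k"
    using v[of "hd xs"] False \<beta> by (intro mult_right_mono) auto
  finally have "ln l \<le> ln (U * (1 - \<beta>) ^ k)" using l by simp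
  also have "\<dots> = ln U + k * ln (1 - \<beta>)"
    using l \<beta> by (simp add: ln_mult ln_realpow)
  \<comment> \<open>The factor \<open>1 / \<beta>\<close> originates here, from ln (1 - \<beta>)
    \<le> - \<beta>.\<close>
  also have "\<dots> \<le> ln U + k * (- \<beta>)"
    using ln_le_minus_one[of "1 - \<beta>"] \<beta> by (intro add_left_mono mult_left_mono) auto
  finally have "k * \<beta> \<le> ln (U / l)" using l by (simp add: ln_div)
  then have k: "k \<le> ln (U / l) / \<beta>" using \<beta> by (simp add: field_simps)
  have "length xs \<le> 2 * k + 2" unfolding k_def by linarith
  then have "real (length xs) \<le> 2 * real k + 2" by linarith
  \<comment> \<open>The rounding term 2 is at most \<open>2 / \<beta>\<close> because \<beta> <
    1.\<close>
  also have "\<dots> \<le> 2 * (ln (U / l) / \<beta>) + 2 / \<beta>"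
    using k \<beta> by (intro add_mono) (auto simp: field_simps)
  finally show ?thesis by (simp add: algebra_simps)
qed

section \<open>Storing aged memories as words\<close>

text \<open>The age opening each block carries the other tag and doubles as a delimiter, so no
  memory length has to be stored.\<close>

definition enc :: "(nat \<times> 'w list) list \<Rightarrow> ('w + nat) list" where
  "enc xs = concat (map (\<lambda>(a, m). Inr a # map Inl m) xs)"

lemma enc_simps [simp]:
  "enc [] = []" "enc ((a, m) # xs) = Inr a # map Inl m @ enc xs"
  by (auto simp: enc_def)

lemma inj_enc: "inj enc"
proof (rule injI)
  have pre: "takeWhile isl (map Inl m @ enc xs) = map Inl m" for m and xs :: "(nat \<times> 'w list) list"
    by (induction m) (cases xs; auto)+
  fix xs ys :: "(nat \<times> 'w list) list"
  assume "enc xs = enc ys"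
  then show "xs = ys"
  proof (induction xs arbitrary: ys)
    case Nil
    then show ?case by (cases ys) auto
  next
    case (Cons x xs)
    obtain a m where x: "x = (a, m)" by fastforce
    from Cons.prems obtain b n ys' where ys: "ys = (b, n) # ys'"
      by (cases ys) (auto simp: x)
    have eq: "map Inl m @ enc xs = map Inl n @ enc ys'" and "a = b"
      using Cons.prems by (auto simp: x ys)
    have "(map Inl m :: ('w + nat) list) = map Inl n"
      using pre[of m xs] pre[of n ys'] eq by metis
    then have "m = n" by (simp add: inj_map_eq_map)
    then show ?case using eq Cons.IH \<open>a = b\<close> by (simp add: x ys)
  qed
qed

lemma inv_enc [simp]: "inv enc (enc xs) = xs"
  by (rule inv_f_f[OF inj_enc])

lemma length_enc_le:
  assumes "\<And>a m. (a, m) \<in> set xs \<Longrightarrow> length m \<le> s"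
  shows "length (enc xs) \<le> length xs * (s + 1)"
  using assms
proof (induction xs)
  case (Cons x xs)
  obtain a m where x: "x = (a, m)" by fastforce
  have "length m \<le> s" "length (enc xs) \<le> length xs * (s + 1)"
    using Cons by (auto simp: x)
  then show ?case by (simp add: x)
qed simp

lemma enc_in_lists:
  assumes "\<And>a m. (a, m) \<in> set xs \<Longrightarrow> a \<in> N \<and> m \<in> lists W"
  shows "enc xs \<in> lists (W <+> N)"
proof -
  have "set (enc xs) \<subseteq> W <+> N"
    unfolding enc_def using assms by (fastforce simp: in_lists_conv_set)
  then show ?thesis by (auto simp: in_lists_conv_set)
qed

section \<open>Suffixes of a stream\<close>

text \<open>Starting points are indexed by age, counted from the end of the stream; each new item
  then adds one to every age.\<close>

definition last_items :: "nat \<Rightarrow> 'a list \<Rightarrow> 'a list" where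
  "last_items a P = drop (length P - a) P"

lemma last_items_0 [simp]: "last_items 0 P = []"
  by (simp add: last_items_def)

lemma last_items_snoc: "last_items (Suc a) (P @ [e]) = last_items a P @ [e]"
  by (simp add: last_items_def)

lemma last_items_split: "a \<le> b \<Longrightarrow> \<exists>D. last_items b P = D @ last_items a P"
proof -
  assume "a \<le> b"
  \<comment> \<open>The inner subtraction accounts for \<open>b\<close> exceeding the length of
    \<open>P\<close>, when \<open>last_items b P\<close> is all of \<open>P\<close>.\<close>
  then have "last_items a P = drop (b - a - (b - length P)) (last_items b P)"
    by (simp add: last_items_def) (rule arg_cong[where f = "\<lambda>n. drop n P"], linarith)
  then show ?thesis by (metis append_take_drop_id)
qed

lemma set_last_items_mono: "a \<le> b \<Longrightarrow> set (last_items a P) \<subseteq> set (last_items b P)"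
  using last_items_split[of a b P] by auto

lemma last_items_in_lists: "P \<in> lists X \<Longrightarrow> last_items a P \<in> lists X"
  by (auto simp: last_items_def in_lists_conv_set dest: in_set_dropD)

lemma last_items_sublist: "prefix P S \<Longrightarrow> sublist (last_items a P) S"
  unfolding last_items_def
  by (meson sublist_drop prefix_imp_sublist sublist_order.order_trans)

lemma window_eq_last_items: "window L P = set (last_items (min L (length P)) P)"
  by (cases "L \<le> length P") (auto simp: window_def last_items_def)

lemma memory_append: "memory A (P @ Q) = foldl (update A) (memory A P) Q"
  by (simp add: memory_def)

lemma memory_Nil: "memory A [] = init A"
  by (simp add: memory_def)

section \<open>The sliding window algorithm\<close>

locale lookahead =
  fixes X :: "'a set" and f :: "'a set \<Rightarrow> real" and \<beta> \<alpha>\<^sub>1 \<alpha>\<^sub>2 :: real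
    and Alg :: "('a, 'w) two_output_alg" and L :: nat
  assumes \<beta>: "0 < \<beta>" "\<beta> < 1" and \<alpha>\<^sub>1: "1 \<le> \<alpha>\<^sub>1" and L: "1 \<le> L"
    and f_nonneg: "f \<in> Pow X \<rightarrow> {0..}" and f_mono: "mono_on (Pow X) f"
    and refined: "refined_lookahead X f \<alpha>\<^sub>1 \<alpha>\<^sub>2 \<beta> Alg"
begin

text \<open>The premise of the second lookahead clause for an earlier start \<open>x\<close> and a
  later start \<open>y\<close>, read off the stored memories.\<close>

definition dominates :: "nat \<times> 'w list \<Rightarrow> nat \<times> 'w list \<Rightarrow> bool" where
  "dominates x y \<longleftrightarrow> (1 - \<beta>) * out1 Alg (snd x) \<le> out1 Alg (snd y)"

text \<open>
  Copies that all have the empty memory behave like a copy that starts now and need not be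
  stored.  This matters only for space bound \<open>s = 0\<close>, where no word may be used for an age.
\<close>

definition collapse :: "(nat \<times> 'w list) list \<Rightarrow> (nat \<times> 'w list) list" where
  "collapse xs = (if init Alg = [] \<and> (\<forall>x\<in>set xs. snd x = []) then [] else xs)"

text \<open>The fresh copy is appended before the update, so it reads \<open>e\<close> and enters
  with age 1. An expired copy can go because the gap below it is already answered for by the next
  one.\<close>

definition step :: "(nat \<times> 'w list) list \<Rightarrow> 'a \<Rightarrow> (nat \<times> 'w list) list" where
  "step xs e = collapse (prune dominates (filter (\<lambda>x. fst x \<le> L)
     (map (\<lambda>x. (Suc (fst x), update Alg (snd x) e)) (xs @ [(0, init Alg)]))))"

text \<open>The oldest stored copy answers; the appended initial memory is the default when nothing
  is stored.\<close>

definition slide :: "('a, 'w + nat) sliding_alg" where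
  "slide = \<lparr>init = [], update = (\<lambda>w e. enc (step (inv enc w) e)),
     out = (\<lambda>w. out2 Alg (snd (hd (inv enc w @ [(0, init Alg)]))))\<rparr>"

definition aged :: "'a list \<Rightarrow> nat \<Rightarrow> nat \<times> 'w list" where
  "aged P a = (a, memory Alg (last_items a P))"

lemma fst_aged [simp]: "fst (aged P a) = a"
  by (simp add: aged_def)

text \<open>Quantifying over all continuations makes the guarantee outlast the copy whose first
  output justified it.\<close>

definition approximates :: "'a list \<Rightarrow> nat \<Rightarrow> nat \<Rightarrow> bool" where
  "approximates P b a \<longleftrightarrow> (\<forall>C\<in>lists X.
     ALG2 Alg (last_items a P @ C) \<le> f (set (last_items b P @ C)) \<and>
     f (set (last_items b P @ C)) \<le> \<alpha>\<^sub>2 * ALG2 Alg (last_items a P @ C))"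

definition follows :: "'a list \<Rightarrow> nat \<Rightarrow> nat \<Rightarrow> bool" where
  "follows P x y \<longleftrightarrow> y < x \<and> (\<forall>b. y \<le> b \<and> b < x \<longrightarrow> approximates P b y)"

text \<open>
  The ages in use, in decreasing order, with a sentinel at either end: age \<open>0\<close> is the copy that
  starts with the next item, and it is not stored.
\<close>

definition covers :: "'a list \<Rightarrow> nat list \<Rightarrow> bool" where
  "covers P ds \<longleftrightarrow> successively (follows P) (Suc (min L (length P)) # ds @ [0])"

section \<open>Consequences of the lookahead property\<close>

lemma ALG1_bounds:
  "T \<in> lists X \<Longrightarrow> ALG1 Alg T \<le> f (set T) \<and> f (set T) \<le> \<alpha>\<^sub>1 * ALG1 Alg T"
  using refined by (auto simp: refined_lookahead_def)

lemma f_set_mono: "T \<in> lists X \<Longrightarrow> set R \<subseteq> set T \<Longrightarrow> f (set R) \<le> f (set T)"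
  by (rule mono_onD[OF f_mono]) (auto simp: in_lists_conv_set)

lemma ALG1_nonneg: "T \<in> lists X \<Longrightarrow> 0 \<le> ALG1 Alg T"
proof -
  assume T: "T \<in> lists X"
  then have "set T \<in> Pow X" by (auto simp: in_lists_conv_set)
  then have "0 \<le> f (set T)" using f_nonneg by (auto simp: Pi_iff)
  then have "0 \<le> \<alpha>\<^sub>1 * ALG1 Alg T" using ALG1_bounds[OF T] by linarith
  then show ?thesis using \<alpha>\<^sub>1 by (simp add: zero_le_mult_iff)
qed

lemma lookaheadD:
  assumes "A \<in> lists X" "B \<in> lists X" "C \<in> lists X"
    and "(1 - \<beta>) * ALG1 Alg (A @ B) \<le> ALG1 Alg B"
  shows "ALG2 Alg (B @ C) \<le> f (set (A @ B @ C)) \<and> f (set (A @ B @ C)) \<le> \<alpha>\<^sub>2 * ALG2 Alg (B @ C)"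
proof -
  have "A @ B @ C \<in> lists X" using assms by simp
  then show ?thesis using refined assms(4) unfolding refined_lookahead_def by blast
qed

lemma approximates_between:
  assumes P: "P \<in> lists X" and "a \<le> b" "b \<le> c"
    and dom: "(1 - \<beta>) * ALG1 Alg (last_items c P) \<le> ALG1 Alg (last_items a P)"
  shows "approximates P b a"
  unfolding approximates_def
proof
  fix C assume C: "C \<in> lists X"
  let ?B = "last_items a P" and ?M = "last_items b P" and ?A = "last_items c P"
  note in_lists = last_items_in_lists[OF P]
  obtain D where D: "?A = D @ ?B" using last_items_split \<open>a \<le> b\<close> \<open>b \<le> c\<close> le_trans by metis
  have "D \<in> lists X" using in_lists[of c] by (simp add: D)
  then have up: "f (set (?A @ C)) \<le> \<alpha>\<^sub>2 * ALG2 Alg (?B @ C)"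
    using lookaheadD[of D ?B C] in_lists C dom by (simp add: D)
  \<comment> \<open>With an empty first part the lookahead premise is trivial, and the bound
    obtained is by \<open>f\<close> of \<open>?B @ C\<close> rather than of the longer
    stream.\<close>
  have "(1 - \<beta>) * ALG1 Alg ?B \<le> ALG1 Alg ?B"
    using ALG1_nonneg[OF in_lists] \<beta> by (simp add: mult_left_le_one_le)
  then have low: "ALG2 Alg (?B @ C) \<le> f (set (?B @ C))"
    using lookaheadD[of "[]" ?B C] in_lists C by simp
  have "f (set (?B @ C)) \<le> f (set (?M @ C))" "f (set (?M @ C)) \<le> f (set (?A @ C))"
    using in_lists C set_last_items_mono[OF \<open>a \<le> b\<close>, of P]
      set_last_items_mono[OF \<open>b \<le> c\<close>, of P]
    by (intro f_set_mono; force)+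
  with up low show "ALG2 Alg (?B @ C) \<le> f (set (?M @ C)) \<and>
      f (set (?M @ C)) \<le> \<alpha>\<^sub>2 * ALG2 Alg (?B @ C)"
    by linarith
qed

lemma approximates_refl: "P \<in> lists X \<Longrightarrow> approximates P a a"
  using approximates_between[of P a a a] ALG1_nonneg[OF last_items_in_lists, of P a] \<beta>
  by (simp add: mult_left_le_one_le)

text \<open>The new item is absorbed into the continuation: \<open>C\<close> becomes
  \<open>e # C\<close>.\<close>

lemma approximates_snoc:
  "approximates P b a \<Longrightarrow> e \<in> X \<Longrightarrow> approximates (P @ [e]) (Suc b) (Suc a)"
  unfolding approximates_def
proof
  fix C assume "\<forall>C\<in>lists X.
     ALG2 Alg (last_items a P @ C) \<le> f (set (last_items b P @ C)) \<and>
     f (set (last_items b P @ C)) \<le> \<alpha>\<^sub>2 * ALG2 Alg (last_items a P @ C)"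
    and "e \<in> X" "C \<in> lists X"
  then show "ALG2 Alg (last_items (Suc a) (P @ [e]) @ C) \<le> f (set (last_items (Suc b) (P @ [e]) @ C)) \<and>
     f (set (last_items (Suc b) (P @ [e]) @ C)) \<le> \<alpha>\<^sub>2 * ALG2 Alg (last_items (Suc a) (P @ [e]) @ C)"
    by (auto simp: last_items_snoc dest!: bspec[where x = "e # C"])
qed

lemma approximates_cong:
  assumes "approximates P b a" "memory Alg (last_items a P) = memory Alg (last_items a' P)"
  shows "approximates P b a'"
  using assms by (simp add: approximates_def ALG2_def memory_append)

lemma follows_snoc: "follows P x y \<Longrightarrow> e \<in> X \<Longrightarrow> follows (P @ [e]) (Suc x) (Suc y)"
  unfolding follows_def by (metis Suc_le_D Suc_le_mono Suc_less_eq approximates_snoc)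

section \<open>Coverage of the window and its preservation\<close>

lemma follows_sorted: "successively (follows P) xs \<Longrightarrow> sorted_wrt (>) xs"
proof -
  assume "successively (follows P) xs"
  then have "successively (>) xs" by (rule successively_mono) (simp add: follows_def)
  then show ?thesis by (simp add: successively_conv_sorted_wrt)
qed

lemma covers_iff:
  "ds \<noteq> [] \<Longrightarrow> covers P ds \<longleftrightarrow> follows P (Suc (min L (length P))) (hd ds) \<and>
     successively (follows P) ds \<and> follows P (last ds) 0"
  by (simp add: covers_def successively_append_iff successively_Cons hd_append)

lemma covers_sorted: "covers P ds \<Longrightarrow> sorted_wrt (>) ds"
  and covers_bounds: "covers P ds \<Longrightarrow> a \<in> set ds \<Longrightarrow> 1 \<le> a \<and> a \<le> min L (length P)"
  unfolding covers_def by (drule follows_sorted, auto simp: sorted_wrt_append)+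

text \<open>The first age not exceeding \<open>b\<close> answers for it, since the entry before it
  exceeds \<open>b\<close>.\<close>

lemma approximates_exists:
  "successively (follows P) (x # ds) \<Longrightarrow> ds \<noteq> [] \<Longrightarrow> last ds \<le> b \<Longrightarrow> b < x \<Longrightarrow>
     \<exists>a\<in>set ds. approximates P b a"
proof (induction ds arbitrary: x)
  case (Cons d ds)
  show ?case
  proof (cases "d \<le> b")
    case True
    then show ?thesis using Cons by (auto simp: follows_def)
  next
    case False
    then have "ds \<noteq> []" using Cons by auto
    then show ?thesis using Cons.IH[of d] Cons.prems False by auto
  qed
qed simp

lemma covers_Nil: "covers [] []"
  by (auto simp: covers_def follows_def intro: approximates_refl)

text \<open>The window's age is one below the upper sentinel, hence in the topmost gap.\<close>

lemma covers_window: "covers P ds \<Longrightarrow> approximates P (min L (length P)) (hd (ds @ [0]))"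
  unfolding covers_def by (cases ds) (simp_all add: follows_def less_Suc_eq_le)

text \<open>Shifting all ages turns the sentinel 0 into the copy of age 1; what remains is to adjust
  the upper sentinel.\<close>

lemma covers_advance:
  assumes cov: "covers P ds" and P: "P \<in> lists X" and e: "e \<in> X"
  defines "es \<equiv> filter (\<lambda>a. a \<le> L) (map Suc (ds @ [0]))"
  shows "covers (P @ [e]) es" and "es \<noteq> []" and "last es = 1"
proof -
  let ?Q = "P @ [e]" and ?M = "min L (length P)"
  obtain d r where dr: "ds @ [0] = d # r" by (cases "ds @ [0]") auto
  have sorted: "sorted_wrt (>) (Suc ?M # d # r)"
    using cov dr follows_sorted by (metis covers_def)
  have succ: "successively (follows ?Q) (Suc (Suc ?M) # Suc d # map Suc r)"
  proof -
    have "successively (follows P) (Suc ?M # d # r)" using cov dr by (simp add: covers_def)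
    then have "successively (\<lambda>x y. follows ?Q (Suc x) (Suc y)) (Suc ?M # d # r)"
      by (rule successively_mono) (use e follows_snoc in blast)
    then have "successively (follows ?Q) (map Suc (Suc ?M # d # r))"
      by (simp only: successively_map)
    then show ?thesis by simp
  qed
  have last_es: "es = filter (\<lambda>a. a \<le> L) (map Suc ds) @ [1]"
    using L by (simp add: es_def)
  then show "es \<noteq> []" "last es = 1" by auto
  \<comment> \<open>Ages were strictly decreasing and at most \<open>L\<close>, so only the head can
    expire.\<close>
  have r: "filter (\<lambda>a. a \<le> L) (map Suc r) = map Suc r"
    using sorted by (intro filter_True) fastforce
  have es: "es = (if Suc d \<le> L then Suc d # map Suc r else map Suc r)"
    by (simp add: es_def dr r)
  have main: "successively (follows ?Q) (Suc (min L (length ?Q)) # es)"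
  proof (cases "Suc d \<le> L")
    case True
    have "follows ?Q (Suc (min L (length ?Q))) (Suc d)"
      using succ True sorted by (auto simp: follows_def)
    then show ?thesis using succ True by (simp add: es)
  next
    case False
    \<comment> \<open>Here \<open>d\<close> equals \<open>L\<close>, and the expired head is exactly
      the new upper sentinel.\<close>
    then have "Suc d = Suc (min L (length ?Q))" using sorted by auto
    then show ?thesis using succ False by (simp add: es)
  qed
  have "follows ?Q 1 0"
    using approximates_refl[of ?Q 0] P e by (auto simp: follows_def)
  then show "covers ?Q es"
    using main \<open>es \<noteq> []\<close> \<open>last es = 1\<close> by (simp add: covers_iff successively_Cons)
qed

text \<open>Gaps opened by pruning are bridged by \<open>approximates_between\<close>; both ends of
  the list survive, so the sentinels still fit.\<close>

lemma covers_prune: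
  assumes cov: "covers P ds" and P: "P \<in> lists X"
  shows "covers P (prune (\<lambda>x y. dominates (aged P x) (aged P y)) ds)"
proof (cases "ds = []")
  case False
  let ?Q = "\<lambda>x y. dominates (aged P x) (aged P y)"
  have "successively (follows P) (prune ?Q ds)"
  proof (rule successively_prune)
    show "successively (follows P) ds"
      using cov False by (simp add: covers_iff)
    show "sorted_wrt (>) ds" using covers_sorted[OF cov] .
    fix x y :: nat assume "x > y" "?Q x y"
    then show "follows P x y"
      unfolding follows_def
      by (auto intro!: approximates_between[OF P, where c = x]
          simp: dominates_def aged_def ALG1_def)
  qed
  then show ?thesis
    using cov False by (simp add: covers_iff hd_prune last_prune)
qed (use cov in simp)

text \<open>Future outputs depend on the memory alone, so age 0 inherits the guarantee of every copy
  whose memory is the initial one.\<close>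

lemma covers_collapse:
  assumes cov: "covers P ds" and "P \<in> lists X"
    and "\<And>a. a \<in> set ds \<Longrightarrow> memory Alg (last_items a P) = init Alg"
  shows "covers P []"
proof -
  have "approximates P b 0" if b: "b < Suc (min L (length P))" for b
  proof -
    obtain a where "a \<in> set (ds @ [0])" "approximates P b a"
      using approximates_exists[OF cov[unfolded covers_def]] b by auto
    then show ?thesis
      using assms(3) by (auto simp: memory_Nil intro: approximates_cong)
  qed
  then show ?thesis by (auto simp: covers_def follows_def)
qed

text \<open>The invariant of the algorithm: coverage gives correctness, sparseness the number of
  copies, and the last clause the case of space 0.\<close>

lemma memory_slide:
  assumes "P \<in> lists X"
  obtains ds where "covers P ds" and "memory slide P = enc (map (aged P) ds)"
    and "sparse dominates (map (aged P) ds)"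
    and "ds \<noteq> [] \<Longrightarrow> init Alg \<noteq> [] \<or> (\<exists>a\<in>set ds. memory Alg (last_items a P) \<noteq> [])"
  using assms
proof (induction P arbitrary: thesis rule: rev_induct)
  case Nil
  show ?case
    by (rule Nil(1)[of "[]"]) (auto simp: covers_Nil memory_Nil slide_def)
next
  case (snoc e P)
  let ?Q = "P @ [e]"
  have P: "P \<in> lists X" and e: "e \<in> X" and Q: "?Q \<in> lists X" using snoc.prems by auto
  obtain ds where cov: "covers P ds" and mem: "memory slide P = enc (map (aged P) ds)"
    using snoc.IH[OF _ P] by blast
  define es where "es = filter (\<lambda>a. a \<le> L) (map Suc (ds @ [0]))"
  define zs where "zs = prune (\<lambda>x y. dominates (aged ?Q x) (aged ?Q y)) es"
  have covz: "covers ?Q zs"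
    unfolding zs_def es_def by (rule covers_prune[OF covers_advance(1)[OF cov P e] Q])
  \<comment> \<open>The appended pair is the copy of age 0, so all pairs advance by the same
    rule.\<close>
  have "map (\<lambda>x. (Suc (fst x), update Alg (snd x) e)) (map (aged P) ds @ [(0, init Alg)]) =
      map (aged ?Q) (map Suc (ds @ [0]))"
    using last_items_snoc[of 0 P e]
    by (auto simp: aged_def last_items_snoc[of _ P e] memory_append memory_Nil)
       (simp add: memory_def)
  then have "step (map (aged P) ds) e = collapse (map (aged ?Q) zs)"
    unfolding step_def zs_def es_def prune_map[symmetric]
    by (simp only: filter_map o_def fst_aged)
  moreover have "memory slide ?Q = enc (step (map (aged P) ds) e)"
    using mem by (simp add: memory_append slide_def)
  ultimately have memQ: "memory slide ?Q = enc (collapse (map (aged ?Q) zs))" by simp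
  show ?case
  proof (cases "init Alg = [] \<and> (\<forall>a\<in>set zs. memory Alg (last_items a ?Q) = [])")
    case True
    then have "collapse (map (aged ?Q) zs) = []" by (auto simp: collapse_def aged_def)
    moreover have "covers ?Q []" using covers_collapse[OF covz Q] True by simp
    ultimately show ?thesis using memQ by (intro snoc.prems(1)[of "[]"]) auto
  next
    case False
    then have "collapse (map (aged ?Q) zs) = map (aged ?Q) zs"
      by (auto simp: collapse_def aged_def)
    moreover have "sparse dominates (map (aged ?Q) zs)"
      by (simp add: sparse_map zs_def sparse_prune)
    ultimately show ?thesis using memQ covz False by (intro snoc.prems(1)[of zs]) auto
  qed
qed

section \<open>Correctness and space of the sliding window algorithm\<close>

lemma slide_maintains_approx:
  assumes S: "S \<in> lists X"
  shows "maintains_approx f \<alpha>\<^sub>2 L slide S"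
  unfolding maintains_approx_def
proof (intro allI impI)
  fix P assume "prefix P S \<and> P \<noteq> []"
  then have P: "P \<in> lists X" using S by (auto simp: prefix_def)
  obtain ds where cov: "covers P ds" and mem: "memory slide P = enc (map (aged P) ds)"
    using memory_slide[OF P] by blast
  have "map (aged P) ds @ [(0, init Alg)] = map (aged P) (ds @ [0])"
    by (simp add: aged_def memory_Nil)
  then have "out slide (memory slide P) = ALG2 Alg (last_items (hd (ds @ [0])) P)"
    using mem by (simp add: slide_def ALG2_def hd_map aged_def del: map_append)
  then show "out slide (memory slide P) \<le> f (window L P) \<and>
      f (window L P) \<le> \<alpha>\<^sub>2 * out slide (memory slide P)"
    using covers_window[OF cov] unfolding approximates_def window_eq_last_items
    by (auto dest!: bspec[where x = "[]"])
qed

lemma slide_uses_space: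
  assumes S: "S \<in> lists X" "S \<noteq> []" and fmin: "0 < f_min f S"
    and space: "\<And>T. sublist T S \<Longrightarrow> uses_space Alg W (real s) T"
  shows "uses_space slide (W <+> {..L}) (4 * (1 / \<beta> * real s * (1 + ln (\<alpha>\<^sub>1 * sigma f S)))) S"
  unfolding uses_space_def
proof (intro allI impI)
  fix P assume pre: "prefix P S"
  then have P: "P \<in> lists X" using S by (auto simp: prefix_def)
  obtain ds where cov: "covers P ds" and mem: "memory slide P = enc (map (aged P) ds)"
    and sp: "sparse dominates (map (aged P) ds)"
    and ne: "ds \<noteq> [] \<Longrightarrow> init Alg \<noteq> [] \<or> (\<exists>a\<in>set ds. memory Alg (last_items a P) \<noteq> [])"
    using memory_slide[OF P] by blast
  have Alg_space: "memory Alg (last_items a P) \<in> lists W \<and> length (memory Alg (last_items a P)) \<le> s" for a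
    using space[OF last_items_sublist[OF pre, of a]] by (auto simp: uses_space_def)
  define l where "l = f_min f S / \<alpha>\<^sub>1"
  have f_min_le: "f_min f S \<le> f {e}" if "e \<in> set S" for e
    using that by (simp add: f_min_def)
  have l: "0 < l" using fmin \<alpha>\<^sub>1 by (simp add: l_def)
  have "l \<le> f_min f S" using fmin \<alpha>\<^sub>1 by (simp add: l_def field_simps)
  also have "\<dots> \<le> f {hd S}" using S by (intro f_min_le) auto
  also have "\<dots> \<le> f (set S)" using f_set_mono[of S "[hd S]"] S by auto
  finally have lU: "l \<le> f (set S)" .
  have ratio: "f (set S) / l = \<alpha>\<^sub>1 * sigma f S" by (simp add: l_def sigma_def)
  have ln_nonneg: "0 \<le> ln (\<alpha>\<^sub>1 * sigma f S)" using l lU unfolding ratio[symmetric] by simp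
  have "real (length ds) \<le> 2 / \<beta> * (1 + ln (f (set S) / l))"
  proof (rule sparse_length_bound[OF _ \<beta> l lU])
    show "sparse (\<lambda>x y. (1 - \<beta>) * ALG1 Alg (last_items x P) \<le> ALG1 Alg (last_items y P)) ds"
      using sp by (simp add: sparse_map dominates_def aged_def ALG1_def)
    fix a assume "a \<in> set ds"
    then have a: "1 \<le> a" "a \<le> length P" using covers_bounds[OF cov] by auto
    let ?T = "last_items a P"
    have T: "?T \<in> lists X" using last_items_in_lists[OF P] .
    have TS: "set ?T \<subseteq> set S"
      using last_items_sublist[OF pre, of a] by (rule set_mono_sublist)
    \<comment> \<open>Stored ages are positive, so each copy has read an item, whose value bounds
      \<open>f\<close> from below by \<open>f_min f S\<close>.\<close>
    have "?T \<noteq> []" using a by (simp add: last_items_def)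
    then have hd: "hd ?T \<in> set ?T" by simp
    have "f_min f S \<le> f {hd ?T}" using hd TS by (intro f_min_le) auto
    also have "\<dots> \<le> f (set ?T)" using f_set_mono[OF T, of "[hd ?T]"] hd by simp
    also have "\<dots> \<le> \<alpha>\<^sub>1 * ALG1 Alg ?T" using ALG1_bounds[OF T] by simp
    finally have "l \<le> ALG1 Alg ?T" using \<alpha>\<^sub>1 by (simp add: l_def field_simps)
    moreover have "ALG1 Alg ?T \<le> f (set S)"
      using ALG1_bounds[OF T] f_set_mono[OF S(1) TS] by linarith
    ultimately show "l \<le> ALG1 Alg ?T \<and> ALG1 Alg ?T \<le> f (set S)" by simp
  qed
  then have len: "real (length ds) \<le> 2 / \<beta> * (1 + ln (\<alpha>\<^sub>1 * sigma f S))" unfolding ratio .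
  have "real (length (memory slide P)) \<le> 4 * (1 / \<beta> * real s * (1 + ln (\<alpha>\<^sub>1 * sigma f S)))"
  proof (cases "s = 0")
    case True
    \<comment> \<open>Not even an age may be stored now; all memories are empty, so collapsing has
      left no copy.\<close>
    then have "memory Alg (last_items a P) = []" for a using Alg_space by simp
    then have "ds = []" using ne memory_Nil[of Alg] last_items_0 by metis
    then show ?thesis using mem True by simp
  next
    case False
    have "length (memory slide P) \<le> length ds * (s + 1)"
      unfolding mem using length_enc_le[of "map (aged P) ds" s] Alg_space by (auto simp: aged_def)
    then have "real (length (memory slide P)) \<le> real (length ds) * real (s + 1)"
      by (metis of_nat_le_iff of_nat_mult)
    \<comment> \<open>The constant 4 is 2 from the number of copies times 2 from s + 1 \<le> 2 s,
      the extra word being the age.\<close>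
    also have "\<dots> \<le> (2 / \<beta> * (1 + ln (\<alpha>\<^sub>1 * sigma f S))) * (2 * real s)"
      using len False \<beta> ln_nonneg by (intro mult_mono) auto
    finally show ?thesis by (simp add: mult_ac)
  qed
  moreover have "memory slide P \<in> lists (W <+> {..L})"
    unfolding mem using Alg_space covers_bounds[OF cov]
    by (intro enc_in_lists) (auto simp: aged_def)
  ultimately show "memory slide P \<in> lists (W <+> {..L}) \<and>
      real (length (memory slide P)) \<le> 4 * (1 / \<beta> * real s * (1 + ln (\<alpha>\<^sub>1 * sigma f S)))"
    by simp
qed

end

text \<open>\<open>Slide\<close> is fixed before \<open>S\<close>, so it knows neither the stream
  nor its \<open>sigma\<close>. Space of \<open>Alg\<close> is bounded on sublists because each copy
  reads a contiguous piece of \<open>S\<close>. The summand 1 keeps the bound from vanishing for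
  positive \<open>s\<close> when the logarithm is 0.\<close>

theorem theorem7:
  "\<exists>K > 0. \<forall>(X :: 'a set) (f :: 'a set \<Rightarrow> real) (\<beta> :: real) (\<alpha>\<^sub>1 :: real) (\<alpha>\<^sub>2 :: real)
      (Alg :: ('a, 'w) two_output_alg) (L :: nat).
     0 < \<beta> \<and> \<beta> < 1 \<and> 1 \<le> \<alpha>\<^sub>1 \<and> 1 \<le> \<alpha>\<^sub>2 \<and> 1 \<le> L \<and>
     f \<in> Pow X \<rightarrow> {0..} \<and> mono_on (Pow X) f \<and>
     refined_lookahead X f \<alpha>\<^sub>1 \<alpha>\<^sub>2 \<beta> Alg
     \<longrightarrow> (\<exists>Slide :: ('a, 'w + nat) sliding_alg.
           \<forall>S \<in> lists X.
             maintains_approx f \<alpha>\<^sub>2 L Slide S \<and>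
             (\<forall>(W :: 'w set) (s :: nat).
                S \<noteq> [] \<and> 0 < f_min f S \<and>
                (\<forall>T. sublist T S \<longrightarrow> uses_space Alg W (real s) T)
                \<longrightarrow> uses_space Slide (W <+> {..L})
                      (K * (1 / \<beta> * real s * (1 + ln (\<alpha>\<^sub>1 * sigma f S)))) S))"
proof (intro exI[of _ 4] conjI allI impI)
  fix X :: "'a set" and f \<beta> \<alpha>\<^sub>1 \<alpha>\<^sub>2 and Alg :: "('a, 'w) two_output_alg" and L :: nat
  assume "0 < \<beta> \<and> \<beta> < 1 \<and> 1 \<le> \<alpha>\<^sub>1 \<and> 1 \<le> \<alpha>\<^sub>2 \<and> 1 \<le> L \<and>
     f \<in> Pow X \<rightarrow> {0..} \<and> mono_on (Pow X) f \<and> refined_lookahead X f \<alpha>\<^sub>1 \<alpha>\<^sub>2 \<beta> Alg"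
  then interpret lookahead X f \<beta> \<alpha>\<^sub>1 \<alpha>\<^sub>2 Alg L by unfold_locales auto
  show "\<exists>Slide :: ('a, 'w + nat) sliding_alg. \<forall>S \<in> lists X.
      maintains_approx f \<alpha>\<^sub>2 L Slide S \<and>
      (\<forall>(W :: 'w set) (s :: nat). S \<noteq> [] \<and> 0 < f_min f S \<and>
         (\<forall>T. sublist T S \<longrightarrow> uses_space Alg W (real s) T)
         \<longrightarrow> uses_space Slide (W <+> {..L}) (4 * (1 / \<beta> * real s * (1 + ln (\<alpha>\<^sub>1 * sigma f S)))) S)"
    using slide_maintains_approx slide_uses_space by (intro exI[of _ slide]) blast
qed simp

end
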